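(* There exists a universal constant $C>0$ such that for every positive integer $r$ there exists a bipartite graph $G$ on $C(1000r)^{1000r}$ vertices satisfying $\theta(G)\geq r$. In particular, there exists a universal constant $c'>0$ such that for all integers $n\geq 3$ we have \[ \theta(n)\geq c'\frac{\log n}{\log\log n}. \]
   Context: An interval colouring of a graph $G=(V,E)$ is an edge-colouring $c\colon E\to\mathbb{Z}$ such that for every vertex $x$, the multiset $\{c(xy): xy\in E\}$ of colours of edges incident to $x$ forms an interval of $\mathbb{Z}$ (in particular it is a proper edge-colouring). A graph is interval colourable if it admits an interval colouring. The interval thickness $\theta(G)$ of a graph $G$ is the smallest integer $k$ such that the edge set of $G$ can be partitioned into $k$ sets each inducing an interval colourable graph. $\theta(n)$ denotes the maximum of $\theta(G)$ over all graphs $G$ on $n$ vertices. *)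

theory Defs
  imports Complex_Main "HOL-Library.Multiset" "HOL-Library.Disjoint_Sets" "HOL-Library.Ramsey"
begin

text \<open>A graph is a pair of a vertex set and a set of edges, an edge being a two-element set of
  vertices. Graphs are finite and simple.\<close>

type_synonym 'a graph = "'a set \<times> 'a set set"

abbreviation verts :: "'a graph \<Rightarrow> 'a set" where "verts \<equiv> fst"
abbreviation edges :: "'a graph \<Rightarrow> 'a set set" where "edges \<equiv> snd"

definition fin_simple_graph :: "'a graph \<Rightarrow> bool" where
  "fin_simple_graph G \<longleftrightarrow> finite (verts G) \<and> edges G \<subseteq> nsets (verts G) 2"

definition bipartite :: "'a graph \<Rightarrow> bool" where
  "bipartite G \<longleftrightarrow>
     (\<exists>A B. A \<union> B = verts G \<and> A \<inter> B = {} \<and>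
            (\<forall>e\<in>edges G. \<exists>a\<in>A. \<exists>b\<in>B. e = {a, b}))"

text \<open>The colours at each vertex, counted with multiplicity, are those of an integer interval
  \<open>{a..b}\<close>, each occurring once. The choice \<open>a > b\<close> gives the empty interval, so an isolated
  vertex imposes no condition. Only the values of \<open>c\<close> on edges matter.\<close>

definition interval_colouring :: "'a graph \<Rightarrow> ('a set \<Rightarrow> int) \<Rightarrow> bool" where
  "interval_colouring G c \<longleftrightarrow>
     (\<forall>x\<in>verts G. \<exists>a b. image_mset c (mset_set {e \<in> edges G. x \<in> e}) = mset_set {a..b})"

definition interval_colourable :: "'a graph \<Rightarrow> bool" where
  "interval_colourable G \<longleftrightarrow> (\<exists>c. interval_colouring G c)"

definition edge_induced :: "'a set set \<Rightarrow> 'a graph" where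
  "edge_induced F = (\<Union>F, F)"

text \<open>Since \<^const>\<open>partition_on\<close> requires nonempty parts, an edgeless graph has thickness 0.
  For a finite graph the set of admissible \<open>k\<close> is nonempty, because a single edge is interval
  colourable.\<close>

definition interval_thickness :: "'a graph \<Rightarrow> nat" where
  "interval_thickness G =
     (LEAST k. \<exists>P. partition_on (edges G) P \<and> finite P \<and> card P = k \<and>
                   (\<forall>F\<in>P. interval_colourable (edge_induced F)))"

text \<open>Every finite graph is isomorphic to one with vertices in \<^typ>\<open>nat\<close>. The set below is
  finite, as the interval thickness is at most the number of edges.\<close>

definition max_interval_thickness :: "nat \<Rightarrow> nat" where
  "max_interval_thickness n =
     Max {interval_thickness G | G :: nat graph. fin_simple_graph G \<and> card (verts G) = n}"

end

theory Submission
  imports Defs "HOL-Library.FuncSet"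
begin

text \<open>Join each point of a set \<open>Y\<close> to the blocks containing it, where the blocks come in \<open>k + 1\<close> levels
  and each point lies in \<open>m\<close> blocks of each level. Suppose the edges are split into at most \<open>k\<close>
  interval coloured parts. At every point, each level has a most popular part, and two levels
  \<open>i < j\<close> share it. Averaging gives a point \<open>y\<close>, a block \<open>x\<close> of level \<open>j\<close> through \<open>y\<close> and one part
  containing, for many blocks \<open>z\<close> of level \<open>i\<close> through \<open>y\<close>, a positive proportion of the paths
  \<open>x - y' - z - y - x\<close>; here \<open>z\<close> is a subset of \<open>x\<close>. Along such a path the colour changes by less
  than \<open>d i\<close>, the size of \<open>z\<close>, plus twice the degree of a point, so the colours of the edges \<open>xy'\<close>
  lie in an interval of length \<open>O(d i)\<close>. As the blocks \<open>z\<close> are nearly disjoint, there are too many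
  \<open>y'\<close> for these colours to be distinct.

  The points are \<open>(k + 1)\<close>-tuples of points in a \<open>q\<close> by \<open>m q\<close> grid. A block of level \<open>i\<close> fixes the
  coordinates above \<open>i\<close>, frees those below, and restricts coordinate \<open>i\<close> to a line of slope \<open>s < m\<close>.
  Everything is polynomial in \<open>k\<close> per level, so the graph has \<open>k ^ O(k)\<close> vertices.\<close>

section \<open>Nested block systems\<close>

text \<open>There are at least \<open>n * card A\<close> pairs \<open>(a, t)\<close> with
  \<open>R a t\<close>, so some \<open>t\<close> occurs in at least the average number of
  them.\<close>

lemma double_counting_pigeonhole:
  assumes "finite A" "finite T" "T \<noteq> {}"
    and "\<And>a. a \<in> A \<Longrightarrow> n \<le> card {t \<in> T. R a t}"
  obtains t where "t \<in> T" "n * card A \<le> card T * card {a \<in> A. R a t}"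
proof -
  have "\<exists>t\<in>T. n * card A \<le> card T * card {a \<in> A. R a t}"
  proof (rule ccontr)
    assume "\<not> ?thesis"
    then have less: "\<And>t. t \<in> T \<Longrightarrow> card T * card {a \<in> A. R a t} < n * card A"
      by force
    have "n * card A \<le> (\<Sum>a\<in>A. card {t \<in> T. R a t})"
      using sum_bounded_below[of A n, OF assms(4)] by (simp add: mult.commute)
    also have "\<dots> = (\<Sum>t\<in>T. card {a \<in> A. R a t})"
      using assms(1,2) by (intro sum_multicount_gen) auto
    finally have "card T * (n * card A) \<le> (\<Sum>t\<in>T. card T * card {a \<in> A. R a t})"
      by (simp add: sum_distrib_left [symmetric])
    also have "\<dots> < (\<Sum>t\<in>T. n * card A)"
      using less assms(2,3) by (intro sum_strict_mono) auto
    finally show False by simp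
  qed
  then show thesis using that by blast
qed

text \<open>Prepares the final contradiction: distinct integer colours cannot crowd into a short
  window.\<close>

lemma card_le_of_small_spread:
  fixes g :: "'a \<Rightarrow> int"
  assumes "inj_on g P" "\<And>y. y \<in> P \<Longrightarrow> \<bar>g y - v\<bar> < int L"
  shows "card P \<le> 2 * L"
proof -
  have "g ` P \<subseteq> {v - int L<..<v + int L}"
  proof
    fix z assume "z \<in> g ` P"
    then obtain y where "y \<in> P" "z = g y" by blast
    then show "z \<in> {v - int L<..<v + int L}" using assms(2)[of y] by auto
  qed
  then have "card (g ` P) \<le> card {v - int L<..<v + int L}" by (intro card_mono) auto
  then show ?thesis using card_image[OF assms(1)] by simp
qed

text \<open>Blocks are given by labels: \<open>B i s y\<close> names the block of level
  \<open>i\<close> and direction \<open>s\<close> through \<open>y\<close>, and its points are a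
  fibre of \<open>B i s\<close>. The number \<open>d i\<close> is a nominal block size:
  \<open>card_blocks\<close> allows twice as many blocks as there would be if all had exactly
  \<open>d i\<close> points. By \<open>block_nested\<close>, a block lies inside every block of
  higher level through any of its points.\<close>

locale nested_blocks =
  fixes Y :: "'y set" and B :: "nat \<Rightarrow> nat \<Rightarrow> 'y \<Rightarrow> 'b" and k m q :: nat and d :: "nat \<Rightarrow> nat"
  assumes finite_Y: "finite Y" and nonempty_Y: "Y \<noteq> {}"
    and block_eqD: "B i s y = B i' s' y' \<Longrightarrow> i = i' \<and> s = s'"
    and card_block: "\<lbrakk>i \<le> k; y \<in> Y; s < m\<rbrakk> \<Longrightarrow> card {y' \<in> Y. B i s y' = B i s y} \<le> d i"
    and card_block_inter: "\<lbrakk>i \<le> k; y \<in> Y; s < m; s' < m; s \<noteq> s'\<rbrakk> \<Longrightarrow>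
          q * card {y' \<in> Y. B i s y' = B i s y \<and> B i s' y' = B i s' y} \<le> d i"
    and card_blocks: "i \<le> k \<Longrightarrow> card ((\<lambda>(y, s). B i s y) ` (Y \<times> {..<m})) * d i \<le> 2 * m * card Y"
    and block_nested: "\<lbrakk>i < j; j \<le> k; B i s y = B i s y'\<rbrakk> \<Longrightarrow> B j s' y = B j s' y'"
begin

text \<open>Read \<open>\<kappa> y i s\<close> as the part containing the edge from \<open>y\<close>
  to \<open>B i s y\<close>. On each level some part takes \<open>m0\<close> of the
  \<open>m = k * m0\<close> blocks, and \<open>k + 1\<close> levels with at most \<open>k\<close>
  parts force a repetition. Averaging runs over quadruples \<open>(i, j, c, s')\<close>: including
  \<open>s'\<close> gives each point \<open>m0\<close> of them, which cancels the factor
  \<open>m0\<close> in \<open>card T\<close> and leaves a loss depending on \<open>k\<close>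
  alone.\<close>

lemma dense_level_pair:
  fixes \<kappa> :: "'y \<Rightarrow> nat \<Rightarrow> nat \<Rightarrow> 'c"
  assumes K: "finite K" "card K \<le> k" "\<And>y i s. \<lbrakk>y \<in> Y; i \<le> k; s < m\<rbrakk> \<Longrightarrow> \<kappa> y i s \<in> K"
    and k: "k > 0" and m: "m = k * m0" "m0 > 0"
  obtains i j c s' where "i < j" "j \<le> k" "c \<in> K" "s' < m"
    "card Y \<le> (k\<^sup>2 * (k + 1)\<^sup>2) *
       card {y \<in> Y. \<kappa> y j s' = c \<and> m0 \<le> card {s. s < m \<and> \<kappa> y i s = c}}"
proof -
  define R where "R y = (\<lambda>(i, j, c, s'). i < j \<and> \<kappa> y j s' = c \<and> m0 \<le> card {s. s < m \<and> \<kappa> y i s = c})" for y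
  define T where "T = {..k} \<times> {..k} \<times> K \<times> {..<m}"
  have majority: "\<exists>c\<in>K. m0 \<le> card {s. s < m \<and> \<kappa> y i s = c}" if "y \<in> Y" "i \<le> k" for y i
  proof -
    have mem: "\<kappa> y i s \<in> K" if "s < m" for s
      using K(3) that \<open>y \<in> Y\<close> \<open>i \<le> k\<close> by blast
    have ne: "K \<noteq> {}" using mem[of 0] m k by auto
    obtain c where c: "c \<in> K" "1 * card {..<m} \<le> card K * card {s \<in> {..<m}. \<kappa> y i s = c}"
    proof (rule double_counting_pigeonhole[of "{..<m}" K 1 "\<lambda>s c. \<kappa> y i s = c"])
      fix s assume "s \<in> {..<m}"
      then have "{c \<in> K. \<kappa> y i s = c} = {\<kappa> y i s}" using mem by auto
      then show "1 \<le> card {c \<in> K. \<kappa> y i s = c}" by simp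
    qed (use K ne in auto)
    have "k * m0 \<le> card K * card {s. s < m \<and> \<kappa> y i s = c}" using c(2) m by simp
    also have "\<dots> \<le> k * card {s. s < m \<and> \<kappa> y i s = c}" using K(2) by simp
    finally show ?thesis using c(1) k by auto
  qed
  have many: "m0 \<le> card {t \<in> T. R y t}" if y: "y \<in> Y" for y
  proof -
    obtain c where c: "\<And>i. i \<le> k \<Longrightarrow> c i \<in> K \<and> m0 \<le> card {s. s < m \<and> \<kappa> y i s = c i}"
      using majority[OF y] by metis
    have "card (c ` {..k}) \<le> card K" using c K(1) by (intro card_mono) auto
    then have "\<not> inj_on c {..k}" using K(2) card_image[of c "{..k}"] by auto
    then obtain i j where ij: "i < j" "j \<le> k" "c i = c j"
      unfolding inj_on_def by (metis atMost_iff linorder_neqE_nat)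
    have "card {s. s < m \<and> \<kappa> y j s = c j} \<le> card {t \<in> T. R y t}"
    proof (rule card_inj_on_le[where f = "\<lambda>s. (i, j, c j, s)"])
      show "finite {t \<in> T. R y t}" using K(1) by (simp add: T_def)
      show "(\<lambda>s. (i, j, c j, s)) ` {s. s < m \<and> \<kappa> y j s = c j} \<subseteq> {t \<in> T. R y t}"
        using ij c[of i] c[of j] by (auto simp: T_def R_def)
    qed (auto simp: inj_on_def)
    then show ?thesis using c[of j] ij by simp
  qed
  have "T \<noteq> {}"
  proof
    assume "T = {}"
    then show False using many nonempty_Y m(2) by auto
  qed
  have "finite T" using K(1) by (simp add: T_def)
  then obtain t where t: "t \<in> T" "m0 * card Y \<le> card T * card {y \<in> Y. R y t}"
    by (rule double_counting_pigeonhole[OF finite_Y _ \<open>T \<noteq> {}\<close> many])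
  obtain i j c s' where tt: "t = (i, j, c, s')" by (cases t)
  let ?Y' = "{y \<in> Y. \<kappa> y j s' = c \<and> m0 \<le> card {s. s < m \<and> \<kappa> y i s = c}}"
  have cT: "card T \<le> m0 * (k\<^sup>2 * (k + 1)\<^sup>2)"
  proof -
    have "card T = (k + 1)\<^sup>2 * (card K * m)"
      by (simp add: T_def card_cartesian_product power2_eq_square algebra_simps)
    also have "\<dots> \<le> (k + 1)\<^sup>2 * (k * m)" using K(2) by simp
    finally show ?thesis by (simp add: m power2_eq_square algebra_simps)
  qed
  \<comment> \<open>\<open>T\<close> also contains quadruples with \<open>i \<ge> j\<close>; the
    chosen one has \<open>i < j\<close> because \<open>R\<close> holds for it at some point.\<close>
  have "m0 * card Y > 0" using m(2) finite_Y nonempty_Y by (simp add: card_gt_0_iff)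
  then have "{y \<in> Y. R y t} \<noteq> {}" using t(2) by (metis card.empty mult_0_right not_less)
  then have ij: "i < j" unfolding tt R_def by auto
  then have "{y \<in> Y. R y t} = ?Y'" by (auto simp: tt R_def)
  then have "m0 * card Y \<le> card T * card ?Y'" using t(2) by simp
  also have "\<dots> \<le> m0 * (k\<^sup>2 * (k + 1)\<^sup>2) * card ?Y'" by (rule mult_le_mono1[OF cT])
  finally have "m0 * card Y \<le> m0 * (k\<^sup>2 * (k + 1)\<^sup>2 * card ?Y')" by (simp only: mult.assoc)
  then have "card Y \<le> (k\<^sup>2 * (k + 1)\<^sup>2) * card ?Y'" using m(2) by simp
  then show thesis using that ij t(1) by (auto simp: tt T_def)
qed

text \<open>The combinatorial core, without graphs: \<open>g y i s\<close> stands for the colour of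
  the edge from \<open>y\<close> to \<open>B i s y\<close> and \<open>\<kappa> y i s\<close> for its
  part. Colours of one part at a vertex spread by less than a bound on its degree, which is
  \<open>(k + 1) * m\<close> at a point and \<open>d i\<close> at a block.\<close>

lemma no_interval_labelling:
  fixes \<kappa> :: "'y \<Rightarrow> nat \<Rightarrow> nat \<Rightarrow> 'c" and g :: "'y \<Rightarrow> nat \<Rightarrow> nat \<Rightarrow> int"
  assumes K: "finite K" "card K \<le> k" "\<And>y i s. \<lbrakk>y \<in> Y; i \<le> k; s < m\<rbrakk> \<Longrightarrow> \<kappa> y i s \<in> K"
    and k: "k > 0" and \<theta>: "\<theta> = 4 * k ^ 3 * (k + 1)\<^sup>2" and m: "m = k * (32 * \<theta>)"
    and q: "q \<ge> 32 * \<theta>\<^sup>2" and d: "\<And>i. i \<le> k \<Longrightarrow> q \<le> d i"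
    and point: "\<And>y i s j s'. \<lbrakk>y \<in> Y; i \<le> k; s < m; j \<le> k; s' < m; \<kappa> y i s = \<kappa> y j s'\<rbrakk> \<Longrightarrow>
      \<bar>g y i s - g y j s'\<bar> < int ((k + 1) * m)"
    and block: "\<And>y y' i s. \<lbrakk>y \<in> Y; y' \<in> Y; i \<le> k; s < m; B i s y = B i s y'; \<kappa> y i s = \<kappa> y' i s\<rbrakk> \<Longrightarrow>
      \<bar>g y i s - g y' i s\<bar> < int (d i)"
    and block_inj: "\<And>y y' i s. \<lbrakk>y \<in> Y; y' \<in> Y; i \<le> k; s < m; B i s y = B i s y'; \<kappa> y i s = \<kappa> y' i s;
      g y i s = g y' i s\<rbrakk> \<Longrightarrow> y = y'"
  shows False
proof -
  define t where "t = 16 * \<theta>"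
  have \<theta>0: "\<theta> > 0" using \<theta> k by simp
  have t0: "t > 0" using \<theta>0 by (simp add: t_def)
  have m2: "m = k * (2 * t)" by (simp add: m t_def)
  obtain i j c s' where ij: "i < j" "j \<le> k" and s': "s' < m" and
    large: "card Y \<le> (k\<^sup>2 * (k + 1)\<^sup>2) *
       card {y \<in> Y. \<kappa> y j s' = c \<and> 2 * t \<le> card {s. s < m \<and> \<kappa> y i s = c}}"
    by (rule dense_level_pair[OF K k m2]) (use t0 in auto)
  have ik: "i \<le> k" using ij by simp
  define S where "S y = {s. s < m \<and> \<kappa> y i s = c}" for y
  define Y' where "Y' = {y \<in> Y. \<kappa> y j s' = c \<and> 2 * t \<le> card (S y)}"
  have finS: "finite (S y)" for y by (simp add: S_def)
  have finY': "finite Y'" and Y'Y: "Y' \<subseteq> Y" using finite_Y by (auto simp: Y'_def)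
  have large: "card Y \<le> (k\<^sup>2 * (k + 1)\<^sup>2) * card Y'" using large by (simp add: Y'_def S_def)
  define P where "P s y = {y' \<in> Y'. s \<in> S y' \<and> B i s y' = B i s y}" for s y
  have finP: "finite (P s y)" for s y using finY' by (simp add: P_def)
  \<comment> \<open>\<open>P s y\<close> collects the points of the block that continue a path
    within part \<open>c\<close>. A pair is bad if they make up at most a proportion
    \<open>1 / \<theta>\<close> of the size \<open>d i\<close>.\<close>
  define bad where "bad = {(y, s). y \<in> Y' \<and> s \<in> S y \<and> \<theta> * card (P s y) \<le> d i}"
  have bad_sub: "bad \<subseteq> Y \<times> {..<m}" using Y'Y by (auto simp: bad_def S_def)
  then have finbad: "finite bad" using finite_Y by (meson finite_SigmaI finite_lessThan finite_subset)
  have "\<theta> * card bad \<le> 2 * m * card Y"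
  proof -
    let ?F = "\<lambda>(y, s). B i s y"
    have fib: "\<theta> * card {x \<in> bad. ?F x = z} \<le> d i" if z: "z \<in> ?F ` bad" for z
    proof -
      obtain y s where ys: "(y, s) \<in> bad" "z = B i s y" using z by auto
      \<comment> \<open>The bad pairs of one block share its direction, and their points all belong
        to the same small set \<open>P s y\<close>.\<close>
      have "{x \<in> bad. ?F x = z} \<subseteq> P s y \<times> {s}"
      proof
        fix x assume x: "x \<in> {x \<in> bad. ?F x = z}"
        obtain y' s'' where x': "x = (y', s'')" by (cases x)
        then have "s'' = s" using x ys block_eqD by fastforce
        then show "x \<in> P s y \<times> {s}" using x x' ys by (simp add: bad_def P_def)
      qed
      then have "card {x \<in> bad. ?F x = z} \<le> card (P s y \<times> {s})"
        using finP by (intro card_mono) auto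
      then have "\<theta> * card {x \<in> bad. ?F x = z} \<le> \<theta> * card (P s y)" by (simp add: card_cartesian_product)
      also have "\<dots> \<le> d i" using ys by (simp add: bad_def)
      finally show ?thesis .
    qed
    have "card bad = (\<Sum>z\<in>?F ` bad. card {x \<in> bad. ?F x = z})"
      unfolding card_eq_sum by (rule sum.image_gen[OF finbad])
    then have "\<theta> * card bad = (\<Sum>z\<in>?F ` bad. \<theta> * card {x \<in> bad. ?F x = z})"
      by (simp add: sum_distrib_left)
    also have "\<dots> \<le> card (?F ` bad) * d i"
      using sum_bounded_above[of "?F ` bad" _ "d i", OF fib] by simp
    also have "\<dots> \<le> card (?F ` (Y \<times> {..<m})) * d i"
      using bad_sub finite_Y by (intro mult_le_mono1 card_mono image_mono) auto
    also have "\<dots> \<le> 2 * m * card Y" using card_blocks[OF ik] .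
    finally show ?thesis .
  qed
  also have "\<dots> \<le> 2 * m * ((k\<^sup>2 * (k + 1)\<^sup>2) * card Y')" using large by simp
  \<comment> \<open>This identity dictates \<open>\<theta>\<close>: with
    \<open>m = 2 * k * t\<close> the factor \<open>2 * m * k^2 * (k + 1)^2\<close> is exactly
    \<open>\<theta> * t\<close>.\<close>
  also have "\<dots> = \<theta> * (t * card Y')"
    by (simp add: m2 \<theta> power2_eq_square power3_eq_cube algebra_simps)
  finally have few_bad: "card bad \<le> t * card Y'" using \<theta>0 by simp
  have Y'0: "card Y' > 0"
  proof -
    have "card Y > 0" using finite_Y nonempty_Y by (simp add: card_gt_0_iff)
    then show ?thesis using large by (cases "card Y' = 0") auto
  qed
  \<comment> \<open>Each point of \<open>Y'\<close> has at least \<open>2 * t\<close> directions in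
    \<open>S y\<close>, and on average at most \<open>t\<close> of them are bad.\<close>
  have "\<exists>y\<in>Y'. t \<le> card {s \<in> S y. (y, s) \<notin> bad}"
  proof (rule ccontr)
    assume "\<not> ?thesis"
    then have less: "card {s \<in> S y. (y, s) \<notin> bad} < t" if "y \<in> Y'" for y using that by force
    have "t < card {s \<in> S y. (y, s) \<in> bad}" if y: "y \<in> Y'" for y
    proof -
      have "card (S y) = card {s \<in> S y. (y, s) \<in> bad} + card {s \<in> S y. (y, s) \<notin> bad}"
        using finS[of y] by (subst card_Un_disjoint [symmetric]) (auto intro: arg_cong[where f = card])
      then show ?thesis using less[OF y] y by (simp add: Y'_def)
    qed
    then have "(\<Sum>y\<in>Y'. t) < (\<Sum>y\<in>Y'. card {s \<in> S y. (y, s) \<in> bad})"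
      using finY' Y'0 by (intro sum_strict_mono) auto
    also have "\<dots> = card (SIGMA y:Y'. {s \<in> S y. (y, s) \<in> bad})"
      using finY' finS by simp
    also have "(SIGMA y:Y'. {s \<in> S y. (y, s) \<in> bad}) = bad" by (auto simp: bad_def)
    finally show False using few_bad by (simp add: mult.commute)
  qed
  then obtain y where y: "y \<in> Y'" "t \<le> card {s \<in> S y. (y, s) \<notin> bad}" by blast
  obtain T where T: "T \<subseteq> {s \<in> S y. (y, s) \<notin> bad}" "card T = t" "finite T"
    by (rule obtain_subset_with_card_n[OF y(2)])
  note finT = T(3) and y = y(1)
  have yY: "y \<in> Y" using y Y'Y by auto
  \<comment> \<open>Points shared with another chosen block through \<open>y\<close> are discarded,
    so the sets \<open>P' s\<close> are disjoint.\<close>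
  define P' where "P' s = P s y - (\<Union>s''\<in>T - {s}. {y' \<in> Y. B i s y' = B i s y \<and> B i s'' y' = B i s'' y})" for s
  have card_P': "d i \<le> 2 * \<theta> * card (P' s)" if s: "s \<in> T" for s
  proof -
    have Tm: "T \<subseteq> {..<m}" using T by (auto simp: S_def)
    let ?Z = "\<lambda>s''. {y' \<in> Y. B i s y' = B i s y \<and> B i s'' y' = B i s'' y}"
    have "card (\<Union>s''\<in>T - {s}. ?Z s'') \<le> (\<Sum>s''\<in>T - {s}. card (?Z s''))"
      using finT by (intro card_UN_le) auto
    then have "q * card (\<Union>s''\<in>T - {s}. ?Z s'') \<le> (\<Sum>s''\<in>T - {s}. q * card (?Z s''))"
      by (simp add: sum_distrib_left [symmetric])
    also have "\<dots> \<le> (\<Sum>s''\<in>T - {s}. d i)"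
      using card_block_inter[OF ik yY] Tm s by (intro sum_mono) blast
    also have "\<dots> \<le> t * d i"
      using card_mono[of T "T - {s}"] finT T(2) by (simp add: card_Diff_subset)
    finally have "q * card (\<Union>s''\<in>T - {s}. ?Z s'') \<le> t * d i" .
    \<comment> \<open>Here the size of \<open>q\<close> enters: the overlaps cost at most
      \<open>d i / (2 * \<theta>)\<close>, half of what a pair that is not bad guarantees.\<close>
    moreover have "2 * \<theta> * t \<le> q" using q by (simp add: t_def power2_eq_square)
    then have "2 * \<theta> * t * card (\<Union>s''\<in>T - {s}. ?Z s'') \<le> q * card (\<Union>s''\<in>T - {s}. ?Z s'')"
      by (rule mult_le_mono1)
    ultimately have "t * (2 * \<theta> * card (\<Union>s''\<in>T - {s}. ?Z s'')) \<le> t * d i"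
      by (simp only: mult.assoc mult.left_commute[of t])
    then have small: "2 * \<theta> * card (\<Union>s''\<in>T - {s}. ?Z s'') \<le> d i" using t0 by simp
    have "d i < \<theta> * card (P s y)" using s T y by (auto simp: bad_def)
    moreover have "card (P s y) \<le> card (P' s) + card (\<Union>s''\<in>T - {s}. ?Z s'')"
    proof -
      have fin: "finite (\<Union>s''\<in>T - {s}. ?Z s'')" using finite_Y finT by auto
      show ?thesis unfolding P'_def using diff_card_le_card_Diff[OF fin, of "P s y"] by linarith
    qed
    then have "\<theta> * card (P s y) \<le> \<theta> * card (P' s) + \<theta> * card (\<Union>s''\<in>T - {s}. ?Z s'')"
      unfolding add_mult_distrib2 [symmetric] by (rule mult_le_mono2)
    ultimately show ?thesis using small by linarith
  qed
  have disj: "P' s \<inter> P' s'' = {}" if "s \<in> T" "s'' \<in> T" "s \<noteq> s''" for s s''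
    using that Y'Y by (auto simp: P'_def P_def)
  have cU: "card (\<Union>s\<in>T. P' s) = (\<Sum>s\<in>T. card (P' s))"
    using finT finP disj by (intro card_UN_disjoint) (auto simp: P'_def)
  have "t * d i \<le> (\<Sum>s\<in>T. 2 * \<theta> * card (P' s))"
    using sum_bounded_below[of T "d i", OF card_P'] T(2) by simp
  also have "\<dots> = 2 * \<theta> * card (\<Union>s\<in>T. P' s)" by (simp add: cU sum_distrib_left)
  \<comment> \<open>The choice \<open>t = 16 * \<theta>\<close> turns
    \<open>t * d i / (2 * \<theta>)\<close> into \<open>8 * d i\<close>.\<close>
  finally have lower: "8 * d i \<le> card (\<Union>s\<in>T. P' s)" using \<theta>0 by (simp add: t_def)
  \<comment> \<open>Three colour changes along the path: one at \<open>y'\<close>, one at the block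
    of level \<open>i\<close>, one at \<open>y\<close>.\<close>
  define L where "L = 2 * ((k + 1) * m) + d i"
  have near: "y' \<in> Y \<and> \<kappa> y' j s' = c \<and> B j s' y' = B j s' y \<and> \<bar>g y' j s' - g y j s'\<bar> < int L"
    if y': "y' \<in> (\<Union>s\<in>T. P' s)" for y'
  proof -
    obtain s where s: "s \<in> T" "y' \<in> P s y" using y' by (auto simp: P'_def)
    have y'Y: "y' \<in> Y" "\<kappa> y' j s' = c" "\<kappa> y' i s = c" "s < m" "B i s y' = B i s y"
      using s(2) by (auto simp: P_def Y'_def S_def)
    have yc: "\<kappa> y j s' = c" "\<kappa> y i s = c" using s(1) T y by (auto simp: Y'_def S_def)
    have "\<bar>g y' j s' - g y' i s\<bar> < int ((k + 1) * m)"
      by (rule point) (use y'Y ij s' in auto)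
    moreover have "\<bar>g y i s - g y j s'\<bar> < int ((k + 1) * m)"
      by (rule point) (use y'Y yY yc ij s' in auto)
    moreover have "\<bar>g y' i s - g y i s\<bar> < int (d i)"
      by (rule block) (use y'Y yY yc ik in auto)
    ultimately have "\<bar>g y' j s' - g y j s'\<bar> < int L" unfolding L_def by linarith
    then show ?thesis using y'Y block_nested[OF ij y'Y(5)] by blast
  qed
  \<comment> \<open>By nesting, all these points lie in the single block \<open>B j s' y\<close>,
    where colours within part \<open>c\<close> are distinct.\<close>
  have "inj_on (\<lambda>y. g y j s') (\<Union>s\<in>T. P' s)"
  proof (rule inj_onI)
    fix y1 y2 assume *: "y1 \<in> (\<Union>s\<in>T. P' s)" "y2 \<in> (\<Union>s\<in>T. P' s)" and eq: "g y1 j s' = g y2 j s'"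
    show "y1 = y2"
      by (rule block_inj[OF _ _ ij(2) s' _ _ eq]) (use near[OF *(1)] near[OF *(2)] in simp_all)
  qed
  then have "card (\<Union>s\<in>T. P' s) \<le> 2 * L"
    using near by (intro card_le_of_small_spread[of "\<lambda>y. g y j s'" _ "g y j s'"]) auto
  \<comment> \<open>Since \<open>(k + 1) * m \<le> q \<le> d i\<close>, the right side is at most
    \<open>6 * d i\<close>, which is impossible for positive \<open>d i\<close>.\<close>
  then have "8 * d i \<le> 4 * ((k + 1) * m) + 2 * d i" using lower by (simp add: L_def)
  moreover have "(k + 1) * m \<le> q"
  proof -
    have "(k + 1) * k \<le> \<theta>"
    proof -
      have "(k + 1) * k * 1 \<le> (k + 1) * k * (4 * k\<^sup>2 * (k + 1))"
        using k by (intro mult_le_mono2) (simp add: Suc_le_eq)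
      also have "\<dots> = \<theta>" by (simp add: \<theta> power2_eq_square power3_eq_cube algebra_simps)
      finally show ?thesis by simp
    qed
    then have "(k + 1) * k * (32 * \<theta>) \<le> \<theta> * (32 * \<theta>)" by (rule mult_le_mono1)
    then show ?thesis using q by (simp add: m power2_eq_square algebra_simps)
  qed
  moreover have "q > 0" using q \<theta>0 by (cases "q = 0") auto
  ultimately show False using d[OF ik] by linarith
qed

end

section \<open>Lines in powers of a grid\<close>

text \<open>The factor \<open>m\<close> in the second side matches the slopes: a line of slope below
  \<open>m\<close> rises by at most \<open>m * q\<close> across the width \<open>q\<close>.\<close>

definition grid :: "nat \<Rightarrow> nat \<Rightarrow> nat \<Rightarrow> (nat \<Rightarrow> nat \<times> nat) set" where
  "grid k m q = {..k} \<rightarrow>\<^sub>E {..<q} \<times> {..<m * q}"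

text \<open>The line is taken over the integers: lines of distinct slopes then meet in at most one point for
  every \<open>q\<close>, prime or not, at the price of fewer than \<open>2 m q\<close> parallel lines (some of them short)
  instead of \<open>m q\<close>.\<close>

definition line_block ::
  "nat \<Rightarrow> nat \<Rightarrow> nat \<Rightarrow> (nat \<Rightarrow> nat \<times> nat) \<Rightarrow> nat \<times> nat \<times> int \<times> (nat \<Rightarrow> nat \<times> nat)" where
  "line_block k i s y = (i, s, int (snd (y i)) - int s * int (fst (y i)), restrict y {i<..k})"

lemma finite_grid: "finite (grid k m q)"
  unfolding grid_def by (intro finite_PiE) auto

lemma card_grid: "card (grid k m q) = (m * q\<^sup>2) ^ (k + 1)"
  unfolding grid_def by (simp add: card_PiE card_cartesian_product power2_eq_square algebra_simps)

lemma card_grid_prefix: "card ({..<i} \<rightarrow>\<^sub>E {..<q} \<times> {..<m * q}) = (m * q\<^sup>2) ^ i"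
  by (simp add: card_PiE card_cartesian_product power2_eq_square algebra_simps)

lemma finite_grid_prefix: "finite ({..<i::nat} \<rightarrow>\<^sub>E {..<q::nat} \<times> {..<m * q})"
  by (intro finite_PiE) auto

lemma restrict_grid: "\<lbrakk>y \<in> grid k m q; i \<le> k\<rbrakk> \<Longrightarrow> restrict y {..<i} \<in> {..<i} \<rightarrow>\<^sub>E {..<q} \<times> {..<m * q}"
  unfolding grid_def PiE_iff by auto

lemma grid_eqI:
  assumes y: "y \<in> grid k m q" "y' \<in> grid k m q" and i: "y i = y' i"
    and "restrict y {..<i} = restrict y' {..<i}" "restrict y {i<..k} = restrict y' {i<..k}"
  shows "y = y'"
proof
  fix j
  consider "j < i" | "j = i" | "i < j" "j \<le> k" | "j > k" by linarith
  then show "y j = y' j"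
  proof cases
    case 1 then show ?thesis using fun_cong[OF assms(4), of j] by simp
  next
    case 2 then show ?thesis using i by simp
  next
    case 3 then show ?thesis using fun_cong[OF assms(5), of j] by simp
  next
    case 4 then show ?thesis using y unfolding grid_def PiE_iff extensional_def by auto
  qed
qed

text \<open>On a fixed line the first entry of coordinate \<open>i\<close> determines the second,
  and the coordinates above \<open>i\<close> are fixed. Only that entry and the coordinates below
  \<open>i\<close> are free.\<close>

lemma card_line_block:
  assumes "i \<le> k"
  shows "card {y' \<in> grid k m q. line_block k i s y' = line_block k i s y} \<le> q * (m * q\<^sup>2) ^ i"
proof -
  have "card {y' \<in> grid k m q. line_block k i s y' = line_block k i s y}
      \<le> card ({..<q} \<times> ({..<i} \<rightarrow>\<^sub>E {..<q} \<times> {..<m * q}))"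
  proof (rule card_inj_on_le[where f = "\<lambda>y'. (fst (y' i), restrict y' {..<i})"])
    show "inj_on (\<lambda>y'. (fst (y' i), restrict y' {..<i})) {y' \<in> grid k m q. line_block k i s y' = line_block k i s y}"
    proof (rule inj_onI)
      fix u v assume *: "u \<in> {y' \<in> grid k m q. line_block k i s y' = line_block k i s y}"
        "v \<in> {y' \<in> grid k m q. line_block k i s y' = line_block k i s y}"
        "(fst (u i), restrict u {..<i}) = (fst (v i), restrict v {..<i})"
      then have "u i = v i" by (auto simp: line_block_def prod_eq_iff)
      then show "u = v" using * by (intro grid_eqI[of u k m q v i]) (auto simp: line_block_def)
    qed
    show "(\<lambda>y'. (fst (y' i), restrict y' {..<i})) ` {y' \<in> grid k m q. line_block k i s y' = line_block k i s y}
        \<subseteq> {..<q} \<times> ({..<i} \<rightarrow>\<^sub>E {..<q} \<times> {..<m * q})"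
    proof
      fix x assume "x \<in> (\<lambda>y'. (fst (y' i), restrict y' {..<i})) ` {y' \<in> grid k m q. line_block k i s y' = line_block k i s y}"
      then obtain y' where y': "y' \<in> grid k m q" and x: "x = (fst (y' i), restrict y' {..<i})" by blast
      have "y' i \<in> {..<q} \<times> {..<m * q}" using y' assms unfolding grid_def PiE_iff by blast
      then show "x \<in> {..<q} \<times> ({..<i} \<rightarrow>\<^sub>E {..<q} \<times> {..<m * q})"
        using restrict_grid[OF y' assms] by (simp add: x mem_Times_iff)
    qed
  qed (intro finite_cartesian_product finite_grid_prefix, simp)
  then show ?thesis by (simp add: card_cartesian_product card_grid_prefix)
qed

text \<open>Lines of distinct slopes through \<open>y i\<close> meet only there, so only the
  coordinates below \<open>i\<close> remain free. Compared with a whole block, a factor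
  \<open>q\<close> is saved.\<close>

lemma card_line_block_inter:
  assumes "i \<le> k" "s \<noteq> s'"
  shows "card {y' \<in> grid k m q. line_block k i s y' = line_block k i s y \<and>
      line_block k i s' y' = line_block k i s' y} \<le> (m * q\<^sup>2) ^ i" (is "card ?Z \<le> _")
proof -
  have coord: "y' i = y i" if "y' \<in> ?Z" for y'
  proof -
    have 1: "int (snd (y' i)) - int s * int (fst (y' i)) = int (snd (y i)) - int s * int (fst (y i))"
      and 2: "int (snd (y' i)) - int s' * int (fst (y' i)) = int (snd (y i)) - int s' * int (fst (y i))"
      using that by (auto simp: line_block_def)
    have "(int s - int s') * (int (fst (y' i)) - int (fst (y i))) = 0"
      using 1 2 by (simp add: algebra_simps)
    then have "fst (y' i) = fst (y i)" using assms(2) by simp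
    then show ?thesis using 1 by (simp add: prod_eq_iff)
  qed
  have "card ?Z \<le> card ({..<i} \<rightarrow>\<^sub>E {..<q} \<times> {..<m * q})"
  proof (rule card_inj_on_le[where f = "\<lambda>y'. restrict y' {..<i}"])
    show "inj_on (\<lambda>y'. restrict y' {..<i}) ?Z"
    proof (rule inj_onI)
      fix u v assume *: "u \<in> ?Z" "v \<in> ?Z" and prefix: "restrict u {..<i} = restrict v {..<i}"
      have "u i = v i" using coord[OF *(1)] coord[OF *(2)] by simp
      moreover have "restrict u {i<..k} = restrict v {i<..k}" using * by (simp add: line_block_def)
      ultimately show "u = v" using * prefix by (intro grid_eqI[of u k m q v i]) simp_all
    qed
    show "(\<lambda>y'. restrict y' {..<i}) ` ?Z \<subseteq> {..<i} \<rightarrow>\<^sub>E {..<q} \<times> {..<m * q}"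
      using restrict_grid[OF _ assms(1)] by (intro image_subsetI) simp
  qed (rule finite_grid_prefix)
  then show ?thesis by (simp only: card_grid_prefix)
qed

text \<open>Count labels: \<open>m\<close> slopes, at most \<open>2 * m * q\<close> intercepts, and
  the coordinates above \<open>i\<close>.\<close>

lemma card_line_blocks:
  assumes "i \<le> k"
  shows "card ((\<lambda>(y, s). line_block k i s y) ` (grid k m q \<times> {..<m})) * (q * (m * q\<^sup>2) ^ i) \<le> 2 * m * card (grid k m q)"
proof -
  let ?U = "{i} \<times> {..<m} \<times> {- int (m * q)..<int (m * q)} \<times> ({i<..k} \<rightarrow>\<^sub>E {..<q} \<times> {..<m * q})"
  have "(\<lambda>(y, s). line_block k i s y) ` (grid k m q \<times> {..<m}) \<subseteq> ?U"
  proof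
    fix b assume "b \<in> (\<lambda>(y, s). line_block k i s y) ` (grid k m q \<times> {..<m})"
    then obtain y s where y: "y \<in> grid k m q" and s: "s \<in> {..<m}" and b: "b = line_block k i s y" by auto
    have yi: "y i \<in> {..<q} \<times> {..<m * q}" using y assms unfolding grid_def PiE_iff by blast
    have "s * fst (y i) \<le> m * q" using yi s by (intro mult_le_mono) (auto simp: mem_Times_iff)
    then have "int s * int (fst (y i)) \<le> int (m * q)" by (metis of_nat_le_iff of_nat_mult)
    moreover have "int (snd (y i)) < int (m * q)"
      using yi unfolding mem_Times_iff by (simp only: of_nat_less_iff lessThan_iff)
    moreover have "int s * int (fst (y i)) \<ge> 0" by simp
    ultimately have "int (snd (y i)) - int s * int (fst (y i)) \<in> {- int (m * q)..<int (m * q)}"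
      unfolding atLeastLessThan_iff by linarith
    moreover have "restrict y {i<..k} \<in> {i<..k} \<rightarrow>\<^sub>E {..<q} \<times> {..<m * q}"
      using y unfolding grid_def PiE_iff by auto
    ultimately show "b \<in> ?U" using s b by (simp add: line_block_def)
  qed
  moreover have "finite ?U" by (intro finite_cartesian_product finite_PiE) auto
  ultimately have "card ((\<lambda>(y, s). line_block k i s y) ` (grid k m q \<times> {..<m})) \<le> card ?U"
    by (rule card_mono [rotated])
  also have "card ?U = m * (2 * (m * q)) * (m * q\<^sup>2) ^ (k - i)"
    by (simp add: card_cartesian_product card_PiE power2_eq_square algebra_simps nat_mult_distrib)
  finally have "card ((\<lambda>(y, s). line_block k i s y) ` (grid k m q \<times> {..<m})) * (q * (m * q\<^sup>2) ^ i)
    \<le> m * (2 * (m * q)) * (m * q\<^sup>2) ^ (k - i) * (q * (m * q\<^sup>2) ^ i)" by (rule mult_le_mono1)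
  also have "\<dots> = 2 * m * ((m * q\<^sup>2) * ((m * q\<^sup>2) ^ (k - i) * (m * q\<^sup>2) ^ i))"
    by (simp add: power2_eq_square algebra_simps)
  also have "(m * q\<^sup>2) ^ (k - i) * (m * q\<^sup>2) ^ i = (m * q\<^sup>2) ^ k"
    using assms by (simp add: power_add [symmetric])
  finally show ?thesis by (simp add: card_grid)
qed

lemma nested_blocks_grid:
  assumes "m > 0" "q > 0"
  shows "nested_blocks (grid k m q) (line_block k) k m q (\<lambda>i. q * (m * q\<^sup>2) ^ i)"
proof
  show "grid k m q \<noteq> {}" using assms card_grid[of k m q] by auto
next
  fix i j s s' y y' assume "i < j" "j \<le> k" "line_block k i s y = line_block k i s y'"
  then have eq: "restrict y {i<..k} = restrict y' {i<..k}" by (simp add: line_block_def)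
  \<comment> \<open>A block of level \<open>i\<close> fixes coordinate \<open>j\<close> and
    everything above it, hence the whole label at level \<open>j\<close>.\<close>
  have ge: "y l = y' l" if "j \<le> l" "l \<le> k" for l
    using fun_cong[OF eq, of l] that \<open>i < j\<close> by simp
  then have "restrict y {j<..k} = restrict y' {j<..k}" by (intro ext) (simp add: restrict_def)
  then show "line_block k j s' y = line_block k j s' y'"
    using ge[of j] \<open>j \<le> k\<close> by (simp add: line_block_def)
next
  fix i s s' :: nat and y assume "i \<le> k" "s \<noteq> s'"
  then show "q * card {y' \<in> grid k m q. line_block k i s y' = line_block k i s y \<and>
      line_block k i s' y' = line_block k i s' y} \<le> q * (m * q\<^sup>2) ^ i"
    by (intro mult_le_mono2 card_line_block_inter)
next
  fix i s i' s' :: nat and y y' assume "line_block k i s y = line_block k i' s' y'"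
  then show "i = i' \<and> s = s'" by (simp add: line_block_def)
qed (simp_all only: finite_grid card_line_block card_line_blocks)

section \<open>Incidence graphs and interval thickness\<close>

text \<open>The two consequences of an interval colouring on which the lower bound rests:
  properness, and a spread below the degree.\<close>

lemma interval_colouring_edge_induced_at:
  assumes "interval_colouring (edge_induced F) c" "finite F"
  shows "inj_on c {e \<in> F. x \<in> e}"
    and "\<lbrakk>e \<in> F; e' \<in> F; x \<in> e; x \<in> e'\<rbrakk> \<Longrightarrow> \<bar>c e - c e'\<bar> < int (card {e \<in> F. x \<in> e})"
proof -
  let ?E = "{e \<in> F. x \<in> e}"
  have fin: "finite ?E" using assms(2) by simp
  have *: "inj_on c ?E \<and> (e \<in> ?E \<longrightarrow> e' \<in> ?E \<longrightarrow> \<bar>c e - c e'\<bar> < int (card ?E))"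
  proof (cases "x \<in> \<Union>F")
    case True
    then obtain a b where ab: "image_mset c (mset_set ?E) = mset_set {a..b}"
      using assms(1) unfolding interval_colouring_def edge_induced_def fst_conv snd_conv by blast
    have im: "c ` ?E = {a..b}" using arg_cong[OF ab, of set_mset] fin by simp
    have card: "card ?E = card {a..b}" using arg_cong[OF ab, of size] by simp
    have "inj_on c ?E" using fin im card by (intro eq_card_imp_inj_on) simp_all
    moreover have "\<bar>c e - c e'\<bar> < int (card ?E)" if "e \<in> ?E" "e' \<in> ?E"
    proof -
      have "c e \<in> {a..b}" "c e' \<in> {a..b}" using that im by blast+
      then show ?thesis by (simp add: card) linarith
    qed
    ultimately show ?thesis by blast
  next
    \<comment> \<open>Such an \<open>x\<close> is no vertex of \<open>edge_induced F\<close>, so the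
      colouring says nothing about it, but it meets no edge of \<open>F\<close> either.\<close>
    case False
    then have no_edges: "?E = {}" by blast
    show ?thesis by (simp only: no_edges) simp
  qed
  show "inj_on c ?E" using * by simp
  show "\<lbrakk>e \<in> F; e' \<in> F; x \<in> e; x \<in> e'\<rbrakk> \<Longrightarrow> \<bar>c e - c e'\<bar> < int (card ?E)" using * by simp
qed

section \<open>Elementary bounds on the interval thickness\<close>

lemma interval_colourable_single_edge: "interval_colourable (edge_induced {e})"
proof -
  have "\<exists>a b. image_mset (\<lambda>_. 0::int) (mset_set {e' \<in> {e}. x \<in> e'}) = mset_set {a..b}" if "x \<in> e" for x
  proof -
    have "{e' \<in> {e}. x \<in> e'} = {e}" using that by blast
    then have "image_mset (\<lambda>_. 0::int) (mset_set {e' \<in> {e}. x \<in> e'}) = mset_set {0..0}" by simp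
    then show ?thesis by blast
  qed
  then have "interval_colouring (edge_induced {e}) (\<lambda>_. 0)"
    unfolding interval_colouring_def edge_induced_def by simp
  then show ?thesis unfolding interval_colourable_def by blast
qed

lemma single_edge_partition:
  "partition_on E ((\<lambda>e. {e}) ` E)" "card ((\<lambda>e. {e}) ` E) = card E"
  by (auto simp: partition_on_def disjoint_def card_image)

text \<open>The partition into single edges shows that the \<open>LEAST\<close> is attained.\<close>

lemma interval_thickness_partition:
  assumes "finite (edges G)"
  obtains P where "partition_on (edges G) P" "finite P" "card P = interval_thickness G"
    "\<And>F. F \<in> P \<Longrightarrow> interval_colourable (edge_induced F)"
proof -
  let ?Q = "\<lambda>k. \<exists>P. partition_on (edges G) P \<and> finite P \<and> card P = k \<and> (\<forall>F\<in>P. interval_colourable (edge_induced F))"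
  have "?Q (card (edges G))"
    using assms single_edge_partition[of "edges G"] interval_colourable_single_edge
    by (intro exI[of _ "(\<lambda>e. {e}) ` edges G"]) auto
  then have "?Q (interval_thickness G)" unfolding interval_thickness_def by (rule LeastI)
  then show thesis using that by blast
qed

lemma interval_thickness_le_card_edges:
  assumes "finite (edges G)"
  shows "interval_thickness G \<le> card (edges G)"
  unfolding interval_thickness_def
  using assms single_edge_partition[of "edges G"] interval_colourable_single_edge
  by (intro Least_le exI[of _ "(\<lambda>e. {e}) ` edges G"]) auto

lemma interval_thickness_pos:
  assumes "finite (edges G)" "edges G \<noteq> {}"
  shows "interval_thickness G > 0"
proof -
  obtain P where P: "partition_on (edges G) P" "finite P" "card P = interval_thickness G"
    using interval_thickness_partition[OF assms(1)] by metis
  have "P \<noteq> {}" using P(1) assms(2) by (auto simp: partition_on_def)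
  then show ?thesis using P by (simp add: card_gt_0_iff flip: P(3))
qed

lemma fin_simple_graph_edges:
  assumes "fin_simple_graph G"
  shows "finite (edges G)" "card (edges G) \<le> card (verts G) choose 2"
proof -
  have *: "finite (verts G)" "edges G \<subseteq> nsets (verts G) 2"
    using assms by (auto simp: fin_simple_graph_def)
  then have fin: "finite (nsets (verts G) 2)" by (simp add: finite_imp_finite_nsets)
  show "finite (edges G)" using finite_subset[OF *(2) fin] .
  show "card (edges G) \<le> card (verts G) choose 2" using card_mono[OF fin *(2)] by simp
qed

text \<open>\<open>Max\<close> needs a finite set; the number of edges bounds all its
  members.\<close>

lemma interval_thickness_le_max:
  fixes G :: "nat graph"
  assumes "fin_simple_graph G"
  shows "interval_thickness G \<le> max_interval_thickness (card (verts G))"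
  unfolding max_interval_thickness_def
proof (rule Max_ge)
  show "finite {interval_thickness G' |G' :: nat graph. fin_simple_graph G' \<and> card (verts G') = card (verts G)}"
  proof (rule finite_subset)
    show "{interval_thickness G' |G' :: nat graph. fin_simple_graph G' \<and> card (verts G') = card (verts G)}
      \<subseteq> {..card (verts G) choose 2}"
    proof
      fix x assume "x \<in> {interval_thickness G' |G' :: nat graph. fin_simple_graph G' \<and> card (verts G') = card (verts G)}"
      then obtain G' :: "nat graph" where G': "x = interval_thickness G'" "fin_simple_graph G'"
        "card (verts G') = card (verts G)" by blast
      show "x \<in> {..card (verts G) choose 2}"
        using order_trans[OF interval_thickness_le_card_edges[OF fin_simple_graph_edges(1)[OF G'(2)]]
          fin_simple_graph_edges(2)[OF G'(2)]] G'(1,3) by simp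
    qed
  qed simp
qed (use assms in blast)

text \<open>A single edge suffices. This serves the small \<open>n\<close> that the construction
  does not reach.\<close>

lemma max_interval_thickness_pos:
  assumes "n \<ge> 2"
  shows "max_interval_thickness n > 0"
proof -
  let ?G = "({..<n}, {{0, 1}}) :: nat graph"
  have "fin_simple_graph ?G" using assms by (auto simp: fin_simple_graph_def nsets_def)
  moreover have "interval_thickness ?G > 0" by (rule interval_thickness_pos) auto
  ultimately show ?thesis using interval_thickness_le_max[of ?G] by simp
qed

section \<open>The incidence graph of a block system\<close>

context nested_blocks
begin

definition incidence_vertices :: "('y + 'b) set" where
  "incidence_vertices = Inl ` Y \<union> (\<lambda>(y, i, s). Inr (B i s y)) ` (Y \<times> {..k} \<times> {..<m})"

text \<open>The map \<open>h\<close> renames points and block labels, so that the graph can later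
  live on natural numbers.\<close>

definition incidence_edges :: "('y + 'b \<Rightarrow> 'v) \<Rightarrow> 'v set set" where
  "incidence_edges h = (\<lambda>(y, i, s). {h (Inl y), h (Inr (B i s y))}) ` (Y \<times> {..k} \<times> {..<m})"

lemma finite_incidence: "finite incidence_vertices" "finite (incidence_edges h)"
  unfolding incidence_vertices_def incidence_edges_def using finite_Y by simp_all

lemma card_incidence_vertices: "card incidence_vertices \<le> card Y * (1 + (k + 1) * m)"
proof -
  have "card incidence_vertices \<le> card (Inl ` Y :: ('y + 'b) set)
      + card ((\<lambda>(y, i, s). Inr (B i s y) :: 'y + 'b) ` (Y \<times> {..k} \<times> {..<m}))"
    unfolding incidence_vertices_def by (rule card_Un_le)
  also have "\<dots> \<le> card Y + card (Y \<times> {..k} \<times> {..<m})"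
    using finite_Y by (intro add_mono card_image_le) auto
  finally show ?thesis by (simp add: card_cartesian_product)
qed

text \<open>A partition into at most \<open>k\<close> interval colourable parts would give, through
  the part and the colour of each edge, a labelling excluded by
  \<open>no_interval_labelling\<close>.\<close>

lemma card_interval_colourable_partition:
  fixes h :: "'y + 'b \<Rightarrow> 'v"
  assumes h: "inj_on h incidence_vertices"
    and P: "partition_on (incidence_edges h) P" "finite P"
    and col: "\<And>F. F \<in> P \<Longrightarrow> interval_colourable (edge_induced F)"
    and k: "k > 0" and \<theta>: "\<theta> = 4 * k ^ 3 * (k + 1)\<^sup>2" and m: "m = k * (32 * \<theta>)"
    and q: "q \<ge> 32 * \<theta>\<^sup>2" and d: "\<And>i. i \<le> k \<Longrightarrow> q \<le> d i"
  shows "k < card P"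
proof (rule ccontr)
  assume "\<not> k < card P"
  then have cardP: "card P \<le> k" by simp
  define E where "E y i s = {h (Inl y), h (Inr (B i s y))}" for y i s
  have E_in: "E y i s \<in> incidence_edges h" if "y \<in> Y" "i \<le> k" "s < m" for y i s
    using that by (force simp: incidence_edges_def E_def)
  have edgeE: "\<exists>y i s. e = E y i s \<and> y \<in> Y \<and> i \<le> k \<and> s < m" if "e \<in> incidence_edges h" for e
    using that by (auto simp: incidence_edges_def E_def)
  have InlV: "Inl y \<in> incidence_vertices" if "y \<in> Y" for y
    using that by (simp add: incidence_vertices_def)
  have InrV: "Inr (B i s y) \<in> incidence_vertices" if "y \<in> Y" "i \<le> k" "s < m" for y i s
    using that by (force simp: incidence_vertices_def)
  have point_in: "h (Inl y) \<in> E y' i s \<longleftrightarrow> y = y'" if "y \<in> Y" "y' \<in> Y" "i \<le> k" "s < m" for y y' i s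
    using inj_onD[OF h _ InlV InlV] inj_onD[OF h _ InlV InrV] that by (fastforce simp: E_def)
  have block_in: "h (Inr (B i s y)) \<in> E y' i' s' \<longleftrightarrow> B i s y = B i' s' y'"
    if "y \<in> Y" "i \<le> k" "s < m" "y' \<in> Y" "i' \<le> k" "s' < m" for y i s y' i' s'
    using inj_onD[OF h _ InrV InlV] inj_onD[OF h _ InrV InrV] that by (fastforce simp: E_def)
  have E_inj: "y = y' \<and> i = i' \<and> s = s'"
    if "E y i s = E y' i' s'" "y \<in> Y" "i \<le> k" "s < m" "y' \<in> Y" "i' \<le> k" "s' < m" for y i s y' i' s'
  proof -
    have "h (Inl y) \<in> E y' i' s'" "h (Inr (B i s y)) \<in> E y' i' s'"
      using that(1) by (auto simp: E_def)
    then have "y = y'" "B i s y = B i' s' y'" using point_in block_in that(2-) by simp_all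
    then show ?thesis using block_eqD by blast
  qed
  have "\<exists>F. F \<in> P \<and> E y i s \<in> F" if "y \<in> Y" "i \<le> k" "s < m" for y i s
    using E_in[OF that] partition_onD1[OF P(1)] by blast
  then obtain \<kappa> where \<kappa>: "\<And>y i s. \<lbrakk>y \<in> Y; i \<le> k; s < m\<rbrakk> \<Longrightarrow> \<kappa> y i s \<in> P \<and> E y i s \<in> \<kappa> y i s"
    by metis
  obtain col where c: "\<And>F. F \<in> P \<Longrightarrow> interval_colouring (edge_induced F) (col F)"
    using col unfolding interval_colourable_def by metis
  have sub: "F \<subseteq> incidence_edges h" if "F \<in> P" for F using that partition_onD1[OF P(1)] by blast
  have finF: "finite F" if "F \<in> P" for F using finite_subset[OF sub[OF that] finite_incidence(2)] .
  define g where "g y i s = col (\<kappa> y i s) (E y i s)" for y i s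
  show False
  proof (rule no_interval_labelling[OF P(2) cardP _ k \<theta> m q d, of \<kappa> g])
    fix y i s assume "y \<in> Y" "i \<le> k" "s < m"
    then show "\<kappa> y i s \<in> P" using \<kappa> by blast
  next
    fix y i s j s' assume *: "y \<in> Y" "i \<le> k" "s < m" "j \<le> k" "s' < m" and eq: "\<kappa> y i s = \<kappa> y j s'"
    let ?F = "{e \<in> \<kappa> y i s. h (Inl y) \<in> e}"
    have F: "\<kappa> y i s \<in> P" "E y i s \<in> \<kappa> y i s" "E y j s' \<in> \<kappa> y i s"
      using \<kappa>[OF *(1,2,3)] \<kappa>[OF *(1,4,5)] eq by auto
    \<comment> \<open>An edge at a point is determined by level and direction, which bounds the
      degree by \<open>(k + 1) * m\<close>.\<close>
    have "?F \<subseteq> (\<lambda>(i, s). E y i s) ` ({..k} \<times> {..<m})"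
    proof
      fix e assume e: "e \<in> ?F"
      obtain y' i' s' where e': "e = E y' i' s'" "y' \<in> Y" "i' \<le> k" "s' < m"
        using edgeE sub[OF F(1)] e by blast
      then have "y = y'" using point_in[OF *(1)] e by blast
      then show "e \<in> (\<lambda>(i, s). E y i s) ` ({..k} \<times> {..<m})" using e' by auto
    qed
    then have "card ?F \<le> card ((\<lambda>(i, s). E y i s) ` ({..k} \<times> {..<m}))" by (intro card_mono) auto
    also have "\<dots> \<le> card ({..k} \<times> {..<m})" by (intro card_image_le) auto
    finally have "card ?F \<le> (k + 1) * m" by (simp add: card_cartesian_product)
    moreover have "\<bar>col (\<kappa> y i s) (E y i s) - col (\<kappa> y i s) (E y j s')\<bar> < int (card ?F)"
      using c[OF F(1)] finF[OF F(1)] F(2,3) by (rule interval_colouring_edge_induced_at) (auto simp: E_def)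
    ultimately show "\<bar>g y i s - g y j s'\<bar> < int ((k + 1) * m)" unfolding g_def eq [symmetric] by linarith
  next
    fix y y' i s assume *: "y \<in> Y" "y' \<in> Y" "i \<le> k" "s < m" and B: "B i s y = B i s y'" and eq: "\<kappa> y i s = \<kappa> y' i s"
    let ?x = "h (Inr (B i s y))"
    let ?F = "{e \<in> \<kappa> y i s. ?x \<in> e}"
    have F: "\<kappa> y i s \<in> P" "E y i s \<in> \<kappa> y i s" "E y' i s \<in> \<kappa> y i s"
      using \<kappa>[OF *(1,3,4)] \<kappa>[OF *(2,3,4)] eq by auto
    have x: "?x \<in> E y i s" "?x \<in> E y' i s" using B by (auto simp: E_def)
    have "?F \<subseteq> (\<lambda>y'. E y' i s) ` {y' \<in> Y. B i s y' = B i s y}"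
    proof
      fix e assume e: "e \<in> ?F"
      obtain y'' i' s' where e': "e = E y'' i' s'" "y'' \<in> Y" "i' \<le> k" "s' < m"
        using edgeE sub[OF F(1)] e by blast
      then have "B i s y = B i' s' y''" using block_in[OF *(1,3,4)] e by blast
      then show "e \<in> (\<lambda>y'. E y' i s) ` {y' \<in> Y. B i s y' = B i s y}"
        using e' block_eqD[of i s y i' s' y''] by auto
    qed
    then have "card ?F \<le> card ((\<lambda>y'. E y' i s) ` {y' \<in> Y. B i s y' = B i s y})"
      using finite_Y by (intro card_mono) auto
    also have "\<dots> \<le> card {y' \<in> Y. B i s y' = B i s y}"
      using finite_Y by (intro card_image_le) auto
    also have "\<dots> \<le> d i" using card_block[OF *(3,1,4)] .
    finally have "card ?F \<le> d i" .
    moreover have "\<bar>col (\<kappa> y i s) (E y i s) - col (\<kappa> y i s) (E y' i s)\<bar> < int (card ?F)"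
      using c[OF F(1)] finF[OF F(1)] F(2,3) x by (rule interval_colouring_edge_induced_at)
    ultimately show "\<bar>g y i s - g y' i s\<bar> < int (d i)" unfolding g_def eq [symmetric] by linarith
    show "y = y'" if "g y i s = g y' i s"
    proof -
      have "inj_on (col (\<kappa> y i s)) ?F"
        using c[OF F(1)] finF[OF F(1)] by (rule interval_colouring_edge_induced_at)
      then have "E y i s = E y' i s"
        using that F(2,3) x unfolding g_def eq [symmetric] by (elim inj_onD) auto
      then show ?thesis using E_inj * by blast
    qed
  qed
qed

text \<open>\<open>V\<close> may exceed the image of \<open>h\<close>. The extra vertices are
  isolated and join the side of the blocks.\<close>

lemma incidence_graph:
  fixes h :: "'y + 'b \<Rightarrow> 'v"
  assumes h: "inj_on h incidence_vertices" and V: "h ` incidence_vertices \<subseteq> V" "finite V"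
  shows "fin_simple_graph (V, incidence_edges h)" "bipartite (V, incidence_edges h)"
proof -
  have in_vertices: "Inl y \<in> incidence_vertices \<and> Inr (B i s y) \<in> incidence_vertices"
    if "y \<in> Y" "i \<le> k" "s < m" for y i s
    using that by (force simp: incidence_vertices_def)
  have vertices: "h (Inl y) \<in> V" "h (Inr (B i s y)) \<in> V" "h (Inr (B i s y)) \<notin> h ` Inl ` Y"
    if "y \<in> Y" "i \<le> k" "s < m" for y i s
  proof -
    show "h (Inl y) \<in> V" "h (Inr (B i s y)) \<in> V" using in_vertices[OF that] V(1) by blast+
    show "h (Inr (B i s y)) \<notin> h ` Inl ` Y"
    proof
      assume "h (Inr (B i s y)) \<in> h ` Inl ` Y"
      then obtain y' where "y' \<in> Y" "h (Inr (B i s y)) = h (Inl y')" by blast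
      then show False using inj_onD[OF h] in_vertices[OF that] in_vertices[OF _ that(2,3)] by blast
    qed
  qed
  have edgeE: "\<exists>y i s. e = {h (Inl y), h (Inr (B i s y))} \<and> y \<in> Y \<and> i \<le> k \<and> s < m"
    if "e \<in> incidence_edges h" for e
    using that by (auto simp: incidence_edges_def)
  have "e \<in> nsets V 2" if e_in: "e \<in> incidence_edges h" for e
  proof -
    obtain y i s where e: "e = {h (Inl y), h (Inr (B i s y))}" and yis: "y \<in> Y" "i \<le> k" "s < m"
      using edgeE[OF e_in] by blast
    have "h (Inl y) \<noteq> h (Inr (B i s y))"
      using vertices(3)[OF yis] imageI[OF imageI[OF yis(1)]] by metis
    then show ?thesis using vertices(1,2)[OF yis] by (simp add: e nsets_def)
  qed
  then show "fin_simple_graph (V, incidence_edges h)" using V(2) by (auto simp: fin_simple_graph_def)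
  have "h ` Inl ` Y \<subseteq> V" using V(1) by (auto simp: incidence_vertices_def)
  moreover have "\<exists>a\<in>h ` Inl ` Y. \<exists>b\<in>V - h ` Inl ` Y. e = {a, b}" if "e \<in> incidence_edges h" for e
    using edgeE[OF that] vertices by blast
  ultimately show "bipartite (V, incidence_edges h)"
    unfolding bipartite_def by (intro exI[of _ "h ` Inl ` Y"] exI[of _ "V - h ` Inl ` Y"]) auto
qed

end

section \<open>Choice of parameters\<close>

text \<open>Here \<open>\<theta>\<close>, \<open>m\<close> and \<open>q\<close> are at most
  constants times \<open>k^5\<close>, \<open>k^6\<close> and \<open>k^10\<close>, so each of the
  \<open>k + 1\<close> coordinates contributes at most \<open>(1000 * k)^26\<close>. The total
  exponent \<open>26 * (k + 1) + 7\<close> is far below \<open>1000 * k\<close>.\<close>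

lemma vertex_count_bound:
  fixes k :: nat
  assumes k: "k > 0" and \<theta>: "\<theta> = 4 * k ^ 3 * (k + 1)\<^sup>2" and m: "m = k * (32 * \<theta>)" and q: "q = 32 * \<theta>\<^sup>2"
  shows "(m * q\<^sup>2) ^ (k + 1) * (1 + (k + 1) * m) \<le> (1000 * k) ^ (1000 * k)"
proof -
  have k1: "k + 1 \<le> 2 * k" using k by simp
  have "\<theta> \<le> 4 * k ^ 3 * (2 * k)\<^sup>2"
    unfolding \<theta> using k1 by (intro mult_le_mono2 power_mono) auto
  also have "\<dots> = 16 * k ^ 5" by algebra
  finally have \<theta>_le: "\<theta> \<le> 16 * k ^ 5" .
  have "m \<le> k * (32 * (16 * k ^ 5))" unfolding m by (intro mult_le_mono2 \<theta>_le)
  also have "\<dots> = 512 * k ^ 6" by algebra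
  finally have m_le: "m \<le> 512 * k ^ 6" .
  have "q \<le> 32 * (16 * k ^ 5)\<^sup>2"
    unfolding q using \<theta>_le by (intro mult_le_mono2 power_mono) auto
  also have "\<dots> = 8192 * k ^ 10" by algebra
  finally have q_le: "q \<le> 8192 * k ^ 10" .
  have "m * q\<^sup>2 \<le> (512 * k ^ 6) * (8192 * k ^ 10)\<^sup>2"
    using m_le q_le by (intro mult_le_mono power_mono) auto
  also have "\<dots> = 34359738368 * k ^ 26" by algebra
  also have "\<dots> \<le> (1000 * k) ^ 26" unfolding power_mult_distrib by (intro mult_le_mono1) simp
  finally have 1: "m * q\<^sup>2 \<le> (1000 * k) ^ 26" .
  have "1 + (k + 1) * m \<le> 1 + (2 * k) * (512 * k ^ 6)"
    using k1 m_le by (intro add_left_mono mult_le_mono)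
  also have "\<dots> = 1 + 1024 * k ^ 7" by algebra
  also have "\<dots> \<le> 1025 * k ^ 7" using one_le_power[of k 7] k by simp
  also have "\<dots> \<le> (1000 * k) ^ 7" unfolding power_mult_distrib by (intro mult_le_mono1) simp
  finally have 2: "1 + (k + 1) * m \<le> (1000 * k) ^ 7" .
  have "(m * q\<^sup>2) ^ (k + 1) * (1 + (k + 1) * m) \<le> ((1000 * k) ^ 26) ^ (k + 1) * (1000 * k) ^ 7"
    using 1 2 by (intro mult_le_mono power_mono) auto
  also have "\<dots> = (1000 * k) ^ (26 * (k + 1) + 7)" by (simp only: power_mult power_add)
  also have "\<dots> \<le> (1000 * k) ^ (1000 * k)" using k by (intro power_increasing) auto
  finally show ?thesis .
qed

text \<open>Take the grid with \<open>r + 1\<close> levels, embed its incidence graph in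
  \<open>{..<n}\<close> and leave the remaining numbers as isolated vertices; this reaches every
  large enough \<open>n\<close> exactly.\<close>

lemma thick_bipartite_graph:
  assumes r: "r > 0" and n: "(1000 * r) ^ (1000 * r) \<le> n"
  obtains G :: "nat graph" where "fin_simple_graph G" "bipartite G" "card (verts G) = n" "interval_thickness G > r"
proof -
  define \<theta> where "\<theta> = 4 * r ^ 3 * (r + 1)\<^sup>2"
  define m where "m = r * (32 * \<theta>)"
  define q where "q = 32 * \<theta>\<^sup>2"
  have "\<theta> > 0" "m > 0" "q > 0" using r by (simp_all add: \<theta>_def m_def q_def)
  then interpret nested_blocks "grid r m q" "line_block r" r m q "\<lambda>i. q * (m * q\<^sup>2) ^ i"
    using nested_blocks_grid by blast
  have "card incidence_vertices \<le> card {..<n}"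
    using card_incidence_vertices vertex_count_bound[OF r \<theta>_def m_def q_def] n by (simp add: card_grid)
  then obtain h :: "_ \<Rightarrow> nat" where h: "inj_on h incidence_vertices" "h ` incidence_vertices \<subseteq> {..<n}"
    using inj_on_iff_card_le[OF finite_incidence(1), of "{..<n}"] by auto
  let ?G = "({..<n}, incidence_edges h)"
  obtain P where P: "partition_on (incidence_edges h) P" "finite P" "card P = interval_thickness ?G"
    "\<And>F. F \<in> P \<Longrightarrow> interval_colourable (edge_induced F)"
    using interval_thickness_partition[of ?G] finite_incidence(2)[of h] by auto
  have "r < card P"
    by (rule card_interval_colourable_partition[OF h(1) P(1,2,4) r \<theta>_def m_def])
      (use \<open>m > 0\<close> \<open>q > 0\<close> in \<open>simp_all add: q_def [symmetric]\<close>)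
  then show thesis using that[of ?G] incidence_graph[OF h] P(3) by simp
qed

section \<open>Asymptotics\<close>

lemma max_interval_thickness_gt:
  assumes "r > 0" "(1000 * r) ^ (1000 * r) \<le> n"
  shows "max_interval_thickness n > r"
  using thick_bipartite_graph[OF assms] interval_thickness_le_max by (metis less_le_trans)

text \<open>With \<open>L = ln n\<close>, the hypothesis gives \<open>1000 * r \<le> L\<close>,
  hence \<open>1000 * r * ln (1000 * r) \<le> 1000 * r * ln L \<le> L\<close>.\<close>

lemma power_self_le_of_ln:
  fixes n r :: nat
  assumes n: "n > 0" "ln (ln (real n)) \<ge> 1" and r: "r > 0" "real r \<le> ln (real n) / (2000 * ln (ln (real n)))"
  shows "(1000 * r) ^ (1000 * r) \<le> n"
proof -
  define L where "L = ln (real n)"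
  \<comment> \<open>By convention \<open>ln 0 = 0\<close>, so \<open>L = 0\<close> would contradict
    \<open>ln L \<ge> 1\<close>.\<close>
  have "L \<noteq> 0" using n(2) by (auto simp: L_def)
  moreover have "L \<ge> 0" using n(1) by (simp add: L_def)
  ultimately have L: "L > 0" by simp
  have M: "ln L \<ge> 1" using n(2) by (simp add: L_def)
  have rM: "2000 * real r * ln L \<le> L"
    using r(2) M by (simp add: L_def [symmetric] pos_le_divide_eq algebra_simps)
  have "1000 * real r \<le> 2000 * real r * ln L" using mult_left_mono[OF M, of "2000 * real r"] by simp
  then have "1000 * real r \<le> L" using rM by linarith
  then have "ln (1000 * real r) \<le> ln L" using r(1) L by (intro ln_mono) auto
  then have "1000 * real r * ln (1000 * real r) \<le> 1000 * real r * ln L" by (intro mult_left_mono) auto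
  also have "\<dots> \<le> L" using rM L by linarith
  finally have "ln (real ((1000 * r) ^ (1000 * r))) \<le> ln (real n)"
    by (simp only: L_def of_nat_power of_nat_mult of_nat_numeral ln_realpow)
  then have "real ((1000 * r) ^ (1000 * r)) \<le> real n"
    using n(1) r(1) by (subst (asm) ln_le_cancel_iff) (simp_all add: zero_less_power)
  then show ?thesis by (simp only: of_nat_le_iff)
qed

text \<open>Equivalent to \<open>exp 1 < 3\<close>, which follows from
  \<open>exp (- 1) \<ge> (7 / 8)^8 > 1 / 3\<close>. It makes \<open>ln (ln n)\<close> positive from
  \<open>n = 3\<close> on.\<close>

lemma one_less_ln_3: "1 < ln (3::real)"
proof -
  have "(7 / 8) ^ 8 \<le> exp (- 1 / 8 :: real) ^ 8"
    using exp_ge_add_one_self[of "- 1 / 8 :: real"] by (intro power_mono) auto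
  also have "\<dots> = exp (- 1)" using exp_of_nat_mult[of 8 "- 1 / 8 :: real"] by simp
  finally have "1 / 3 < exp (- 1 :: real)" by (simp add: field_simps)
  then have "exp 1 < (3::real)" by (simp add: exp_minus field_simps)
  then have "ln (exp 1) < ln (3::real)" by (subst ln_less_cancel_iff) auto
  then show ?thesis by simp
qed

text \<open>For \<open>ln n \<ge> 3\<close> the construction applies and yields
  \<open>1 / 2000\<close>; below that, \<open>ln (ln 3) / 3\<close> brings the left side down to at
  most 1.\<close>

lemma max_interval_thickness_ge:
  assumes n: "n \<ge> 3"
  shows "min (1 / 2000) (ln (ln 3) / 3) * (ln (real n) / ln (ln (real n))) \<le> real (max_interval_thickness n)"
proof -
  define L where "L = ln (real n)"
  have L: "ln 3 \<le> L" using n by (simp add: L_def)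
  have lnln3: "0 < ln (ln (3::real))" using one_less_ln_3 by simp
  have M: "ln (ln 3) \<le> ln L" using L one_less_ln_3 by simp
  have M0: "ln L > 0" using M lnln3 by linarith
  have ratio: "0 \<le> L / ln L" using L one_less_ln_3 M0 by simp
  have pos: "max_interval_thickness n > 0" using n by (intro max_interval_thickness_pos) simp
  show ?thesis
  proof (cases "L \<ge> 3")
    case True
    have "ln L \<ge> ln 3" using True by simp
    then have M1: "ln L \<ge> 1" using one_less_ln_3 by linarith
    define x where "x = L / (2000 * ln L)"
    define r where "r = nat \<lfloor>x\<rfloor>"
    have x0: "x \<ge> 0" using True M0 by (simp add: x_def)
    have r: "real r \<le> x" "x < real (r + 1)" using x0 unfolding r_def by linarith+
    \<comment> \<open>The strict bound from the construction makes up for rounding \<open>x\<close>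
      down to \<open>r\<close>.\<close>
    have "max_interval_thickness n \<ge> r + 1"
    proof (cases "r = 0")
      case False
      have "(1000 * r) ^ (1000 * r) \<le> n"
        using n M1 False r(1) by (intro power_self_le_of_ln) (simp_all add: L_def x_def)
      then show ?thesis using max_interval_thickness_gt[of r n] False by simp
    qed (use pos in simp)
    then have "x \<le> real (max_interval_thickness n)" using r(2) by linarith
    moreover have "min (1 / 2000) (ln (ln 3) / 3) * (L / ln L) \<le> 1 / 2000 * (L / ln L)"
      using ratio by (intro mult_right_mono) auto
    ultimately show ?thesis by (simp add: L_def x_def)
  next
    case False
    have "min (1 / 2000) (ln (ln 3) / 3) * (L / ln L) \<le> ln (ln 3) / 3 * (L / ln L)"
      using ratio by (intro mult_right_mono) auto
    also have "\<dots> \<le> ln L / 3 * (3 / ln L)"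
      by (intro mult_mono divide_right_mono) (use False M M0 lnln3 ratio in linarith)+
    also have "\<dots> = 1" using M0 by simp
    also have "1 \<le> real (max_interval_thickness n)" using pos by simp
    finally show ?thesis by (simp add: L_def)
  qed
qed

theorem theorem1p1:
  "(\<exists>C::real. C > 0 \<and>
      (\<forall>r::nat. r \<ge> 1 \<longrightarrow>
        (\<exists>G :: nat graph. fin_simple_graph G \<and> bipartite G \<and>
           real (card (verts G)) = C * (1000 * real r) ^ (1000 * r) \<and>
           interval_thickness G \<ge> r))) \<and>
   (\<exists>c'::real. c' > 0 \<and>
      (\<forall>n::nat. n \<ge> 3 \<longrightarrow>
        real (max_interval_thickness n) \<ge> c' * (ln (real n) / ln (ln (real n)))))"
proof (intro conjI)
  \<comment> \<open>\<open>C = 1\<close> works, since padding by isolated vertices gives the exact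
    count.\<close>
  have "\<exists>G :: nat graph. fin_simple_graph G \<and> bipartite G \<and>
      real (card (verts G)) = 1 * (1000 * real r) ^ (1000 * r) \<and> interval_thickness G \<ge> r"
    if r: "r \<ge> 1" for r :: nat
  proof -
    obtain G :: "nat graph" where "fin_simple_graph G" "bipartite G"
      "card (verts G) = (1000 * r) ^ (1000 * r)" "interval_thickness G > r"
      using thick_bipartite_graph[of r "(1000 * r) ^ (1000 * r)"] r by auto
    then show ?thesis by (intro exI[of _ G]) simp
  qed
  then show "\<exists>C::real. C > 0 \<and> (\<forall>r::nat. r \<ge> 1 \<longrightarrow>
        (\<exists>G :: nat graph. fin_simple_graph G \<and> bipartite G \<and>
           real (card (verts G)) = C * (1000 * real r) ^ (1000 * r) \<and> interval_thickness G \<ge> r))"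
    by (intro exI[of _ 1]) simp
  have "min (1 / 2000) (ln (ln 3) / 3) > (0::real)" using one_less_ln_3 by simp
  then show "\<exists>c'::real. c' > 0 \<and> (\<forall>n::nat. n \<ge> 3 \<longrightarrow>
        real (max_interval_thickness n) \<ge> c' * (ln (real n) / ln (ln (real n))))"
    using max_interval_thickness_ge by blast
qed

end
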